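(* Let $\tau>0$ be a constant. For each $n\geq 2$ let $H_n$ be an $n\times n$ singular positive semidefinite (Hermitian) matrix whose eigenvalue $0$ has multiplicity exactly one, with eigenvalues $\lambda_1(H_n)\ge\dots\ge\lambda_{n-1}(H_n)>\lambda_n(H_n)=0$. Assume that there is a constant $c$ such that $\lambda_1(H_n)\to c$ and $\lambda_{n-1}(H_n)\to c$ as $n\to\infty$. Then $$S(\varrho_{H_n}^\tau)=\log n-o(1)\qquad (n\to\infty).$$
   Context: For a Hermitian matrix $H$ and real $\tau$, the Gibbs state is $\varrho_H^\tau=\exp(-\tau H)/Z$ with $Z=\mathrm{Tr}(\exp(-\tau H))$. The von Neumann entropy of a density matrix $\varrho$ is $S(\varrho)=-\mathrm{Tr}(\varrho\log\varrho)$, where $\log$ is the natural logarithm. $o(1)$ denotes a sequence (of any sign) converging to $0$. *)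

theory Defs
  imports "Jordan_Normal_Form.Schur_Decomposition"
begin

definition hermitian_mat :: "complex mat \<Rightarrow> bool" where
  "hermitian_mat A \<longleftrightarrow> square_mat A \<and> mat_adjoint A = A"

definition unitary_mat :: "complex mat \<Rightarrow> bool" where
  "unitary_mat U \<longleftrightarrow> square_mat U \<and> mat_adjoint U * U = 1\<^sub>m (dim_row U)"

definition psd_mat :: "complex mat \<Rightarrow> bool" where
  "psd_mat A \<longleftrightarrow> hermitian_mat A \<and>
     (\<forall>v \<in> carrier_vec (dim_row A). 0 \<le> Re ((A *\<^sub>v v) \<bullet>c v))"

(* The k-th largest eigenvalue (k = 1, ..., n) of an n x n Hermitian matrix, counted with
   multiplicity. The real parts lose nothing, since the eigenvalues are real. *)
definition eigval :: "complex mat \<Rightarrow> nat \<Rightarrow> real" where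
  "eigval A k = rev (sorted_list_of_multiset (image_mset Re (proots (char_poly A)))) ! (k - 1)"

definition mat_trace :: "'a::comm_monoid_add mat \<Rightarrow> 'a" where
  "mat_trace A = (\<Sum>i<dim_row A. A $$ (i, i))"

definition mat_exp :: "complex mat \<Rightarrow> complex mat" where
  "mat_exp A = mat (dim_row A) (dim_col A) (\<lambda>(i, j). \<Sum>k. (A ^\<^sub>m k) $$ (i, j) / fact k)"

(* Spectral calculus for Hermitian A: f(A) = U diag(f d_1, ..., f d_n) U^* for any unitary
   diagonalization A = U diag(d_1, ..., d_n) U^*; the result does not depend on the choice
   of U and d. *)
definition herm_fun :: "(real \<Rightarrow> real) \<Rightarrow> complex mat \<Rightarrow> complex mat" where
  "herm_fun f A = (SOME B. \<exists>U d. U \<in> carrier_mat (dim_row A) (dim_row A) \<and> unitary_mat U \<and>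
     A = U * mat_diag (dim_row A) (\<lambda>i. complex_of_real (d i)) * mat_adjoint U \<and>
     B = U * mat_diag (dim_row A) (\<lambda>i. complex_of_real (f (d i))) * mat_adjoint U)"

(* Since ln 0 = 0, a singular density matrix is treated with the convention 0 log 0 = 0
   in the entropy below. *)
definition mat_log :: "complex mat \<Rightarrow> complex mat" where
  "mat_log A = herm_fun ln A"

definition gibbs_state :: "real \<Rightarrow> complex mat \<Rightarrow> complex mat" where
  "gibbs_state \<tau> H =
     (let E = mat_exp (complex_of_real (- \<tau>) \<cdot>\<^sub>m H) in (1 / mat_trace E) \<cdot>\<^sub>m E)"

(* The trace is real for a density matrix, so Re only changes the type. *)
definition vn_entropy :: "complex mat \<Rightarrow> real" where
  "vn_entropy \<rho> = - Re (mat_trace (\<rho> * mat_log \<rho>))"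

end

theory Submission
  imports Defs
begin

text \<open>
  A Gibbs state is a function of \<open>H\<close>, so its entropy depends on the spectrum only: with
  \<open>Z = (\<Sum>i. exp (-\<tau> \<lambda>\<^sub>i))\<close> one has
  \<open>S = ln Z + \<tau> (\<Sum>i. \<lambda>\<^sub>i exp (-\<tau> \<lambda>\<^sub>i)) / Z\<close>
  (\<open>vn_entropy_gibbs_state\<close>). Subtracting \<open>ln n\<close> turns both sums into averages over the spectrum:
  \<open>S - ln n = ln z + \<tau> w / z\<close>, where \<open>z\<close> and \<open>w\<close> are the means of
  \<open>exp (-\<tau> \<lambda>\<^sub>i)\<close> and \<open>\<lambda>\<^sub>i exp (-\<tau> \<lambda>\<^sub>i)\<close>.

  All eigenvalues but the last are squeezed between \<open>\<lambda>\<^sub>n\<^sub>-\<^sub>1\<close> and \<open>\<lambda>\<^sub>1\<close>, hence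
  converge to \<open>c\<close> uniformly, while the single eigenvalue \<open>0\<close> has weight \<open>1/n\<close> in an average.
  So the mean of \<open>g (\<lambda>\<^sub>i)\<close> tends to \<open>g c\<close> for any \<open>g\<close> continuous at \<open>c\<close>
  (\<open>tendsto_average_of_clustering\<close>). This gives \<open>z \<longlonglongrightarrow> exp (-\<tau> c)\<close> and
  \<open>w \<longlonglongrightarrow> c exp (-\<tau> c)\<close>, and the two contributions \<open>-\<tau> c\<close> and \<open>\<tau> c\<close> to the
  limit of \<open>S - ln n\<close> cancel.

  The linear algebra behind the entropy formula is the spectral theorem for Hermitian matrices
  (\<open>hermitian_mat_spectral_decomposition\<close>). It also carries the matrix logarithm, which is
  specified through an arbitrary choice of unitary diagonalization: the trace in the
  entropy does not see that choice, because any two diagonalizations of the same matrix have the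
  same multiset of diagonal entries, namely the roots of the characteristic polynomial.
\<close>

section \<open>Adjoints and unitary matrices\<close>

lemma mat_adjoint_eq_mat:
  "mat_adjoint (A :: complex mat) = mat (dim_col A) (dim_row A) (\<lambda>(i, j). cnj (A $$ (j, i)))"
  by (rule eq_matI) (auto simp: mat_adjoint_def mat_of_rows_index)

lemma mat_adjoint_dim [simp]:
  "dim_row (mat_adjoint (A :: complex mat)) = dim_col A"
  "dim_col (mat_adjoint (A :: complex mat)) = dim_row A"
  by (simp_all add: mat_adjoint_eq_mat)

lemma mat_adjoint_index [simp]:
  "i < dim_col A \<Longrightarrow> j < dim_row A \<Longrightarrow> mat_adjoint (A :: complex mat) $$ (i, j) = cnj (A $$ (j, i))"
  by (simp add: mat_adjoint_eq_mat)

lemma mat_adjoint_carrier [simp, intro]: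
  "(A :: complex mat) \<in> carrier_mat m n \<Longrightarrow> mat_adjoint A \<in> carrier_mat n m"
  by auto

lemma mat_adjoint_mult:
  assumes "(A :: complex mat) \<in> carrier_mat m k" "B \<in> carrier_mat k n"
  shows "mat_adjoint (A * B) = mat_adjoint B * mat_adjoint A"
  using assms by (intro eq_matI) (auto simp: scalar_prod_def mult.commute)

lemma mat_adjoint_adjoint [simp]: "mat_adjoint (mat_adjoint (A :: complex mat)) = A"
  by (rule eq_matI) auto

lemma unitary_mat_mult_adjoint:
  assumes "U \<in> carrier_mat n n" "unitary_mat U"
  shows "mat_adjoint U * U = 1\<^sub>m n" "U * mat_adjoint U = 1\<^sub>m n"
proof -
  show *: "mat_adjoint U * U = 1\<^sub>m n"
    using assms by (auto simp: unitary_mat_def)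
  show "U * mat_adjoint U = 1\<^sub>m n"
    using mat_mult_left_right_inverse[OF _ assms(1) *] assms(1) by auto
qed

lemma unitary_mat_mult:
  assumes U: "U \<in> carrier_mat n n" "unitary_mat U" and V: "V \<in> carrier_mat n n" "unitary_mat V"
  shows "unitary_mat (U * V)"
proof -
  have "mat_adjoint (U * V) * (U * V) = mat_adjoint V * (mat_adjoint U * (U * V))"
    using U V by (simp add: mat_adjoint_mult assoc_mult_mat[of _ n n _ n _ n])
  also have "mat_adjoint U * (U * V) = (mat_adjoint U * U) * V"
    using U V by (simp add: assoc_mult_mat[of _ n n _ n _ n])
  finally show ?thesis
    using carrier_matD[OF U(1)] carrier_matD[OF V(1)] V(1)
    unfolding unitary_mat_mult_adjoint(1)[OF U]
    by (simp add: unitary_mat_mult_adjoint(1)[OF V] unitary_mat_def)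
qed

section \<open>The spectral theorem\<close>

text \<open>
  Gram--Schmidt over an arbitrary conjugatable field cannot take square roots, so it yields only
  pairwise orthogonal nonzero columns. Rescaling each column by the inverse of its norm
  makes the matrix unitary, and an eigenvector among the columns remains one.
\<close>
lemma unitary_of_corthogonal:
  assumes W: "W \<in> carrier_mat n n" and orth: "corthogonal_mat W"
  obtains s where "unitary_mat (W * mat_diag n s)"
proof -
  define s where "s j = complex_of_real (1 / sqrt (Re (col W j \<bullet>c col W j)))" for j
  have *: "(\<Sum>k<n. cnj (W $$ (k, i)) * W $$ (k, j)) = (if i = j then complex_of_real (Re (col W j \<bullet>c col W j)) else 0)
      \<and> 0 < Re (col W j \<bullet>c col W j)" if "i < n" "j < n" for i j
  proof -
    have eq: "(\<Sum>k<n. cnj (W $$ (k, i)) * W $$ (k, j)) = col W j \<bullet>c col W i"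
      using that W by (auto simp: scalar_prod_def lessThan_atLeast0 mult.commute)
    have ne: "col W j \<bullet>c col W j \<noteq> 0"
      using corthogonal_matD[OF orth, of j j] that W by auto
    have "0 \<le> col W j \<bullet>c col W j"
      by (rule conjugate_square_ge_0_vec)
    then have pos: "0 < Re (col W j \<bullet>c col W j)" "Im (col W j \<bullet>c col W j) = 0"
      using ne by (auto simp: less_eq_complex_def complex_eq_iff)
    have "col W j \<bullet>c col W i = 0" if "i \<noteq> j"
      using corthogonal_matD[OF orth, of j i] that \<open>i < n\<close> \<open>j < n\<close> W by auto
    then show ?thesis using pos eq by (auto simp: complex_eq_iff)
  qed
  have "mat_adjoint (W * mat_diag n s) * (W * mat_diag n s) = 1\<^sub>m n"
  proof (rule eq_matI)
    fix i j assume ij: "i < dim_row (1\<^sub>m n :: complex mat)" "j < dim_col (1\<^sub>m n :: complex mat)"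
    have "(mat_adjoint (W * mat_diag n s) * (W * mat_diag n s)) $$ (i, j) =
          (\<Sum>k<n. cnj (W $$ (k, i) * s i) * (W $$ (k, j) * s j))"
      using ij W unfolding mat_diag_mult_right[OF W]
      by (auto simp: scalar_prod_def lessThan_atLeast0)
    also have "\<dots> = cnj (s i) * s j * (\<Sum>k<n. cnj (W $$ (k, i)) * W $$ (k, j))"
      by (simp add: sum_distrib_left algebra_simps)
    also have "\<dots> = (1\<^sub>m n) $$ (i, j)"
    proof (cases "i = j")
      case True
      define r where "r = Re (col W j \<bullet>c col W j)"
      have r: "r > 0" using * ij unfolding r_def by auto
      have "cnj (s j) * s j * complex_of_real r = complex_of_real (1 / sqrt r * (1 / sqrt r) * r)"
        unfolding s_def r_def by (simp only: of_real_mult complex_cnj_complex_of_real)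
      also have "1 / sqrt r * (1 / sqrt r) * r = 1" using r by simp
      finally show ?thesis using * ij True by (simp add: r_def)
    qed (use * ij in auto)
    finally show "(mat_adjoint (W * mat_diag n s) * (W * mat_diag n s)) $$ (i, j) = 1\<^sub>m n $$ (i, j)" .
  qed (use W in \<open>auto simp: mat_diag_def\<close>)
  then have "unitary_mat (W * mat_diag n s)"
    using W by (auto simp: unitary_mat_def mat_diag_def)
  then show thesis by (rule that)
qed

text \<open>
  The deflation step of the spectral theorem: an eigenvector, which exists by the fundamental
  theorem of algebra, is extended to an orthonormal basis.
\<close>
lemma unitary_with_eigenvector_first:
  assumes A: "(A :: complex mat) \<in> carrier_mat n n" and n: "n > 0"
  obtains U e where "U \<in> carrier_mat n n" "unitary_mat U" "A *\<^sub>v col U 0 = e \<cdot>\<^sub>v col U 0"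
proof -
  have "\<not> constant (poly (char_poly A))"
    using degree_monic_char_poly[OF A] n by (simp add: constant_degree)
  then obtain e where "poly (char_poly A) e = 0"
    using fundamental_theorem_of_algebra by blast
  then have "eigenvalue A e"
    using eigenvalue_root_char_poly[OF A] by simp
  then obtain v where ev: "v \<in> carrier_vec n" "v \<noteq> 0\<^sub>v n" "A *\<^sub>v v = e \<cdot>\<^sub>v v"
    using A by (auto simp: eigenvalue_def eigenvector_def)
  interpret cof_vec_space n "TYPE(complex)" .
  define b where "b = basis_completion v"
  define ws where "ws = gram_schmidt n b"
  define W where "W = mat_of_cols n ws"
  from basis_completion[OF ev(1,2), folded b_def]
  have "distinct b" "\<not> lin_dep (set b)" "set b \<subseteq> carrier_vec n" "hd b = v" "length b = n"
    by auto
  note b = this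
  obtain vs where bv: "b = v # vs" using b n by (cases b) auto
  from gram_schmidt_result[OF b(3,1,2) refl, folded ws_def] b
  have ws: "set ws \<subseteq> carrier_vec n" "corthogonal ws" "length ws = n" by auto
  have hdws: "hd ws = v" using gram_schmidt_hd[OF ev(1), of vs] bv unfolding ws_def by simp
  have W: "W \<in> carrier_mat n n" using ws unfolding W_def by auto
  have "corthogonal_mat W" using orthogonal_mat_of_cols ws unfolding W_def by blast
  then obtain s where s: "unitary_mat (W * mat_diag n s)"
    using unitary_of_corthogonal[OF W] by blast
  have "col W 0 = v"
    using hdws ws n unfolding W_def by (cases ws) (auto simp: col_mat_of_cols)
  then have W0: "W $$ (i, 0) = v $ i" if "i < n" for i
    using W n that by (metis index_col carrier_matD)
  have col: "col (W * mat_diag n s) 0 = s 0 \<cdot>\<^sub>v v"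
    using W ev(1) n unfolding mat_diag_mult_right[OF W] by (intro eq_vecI) (auto simp: W0)
  have "A *\<^sub>v (s 0 \<cdot>\<^sub>v v) = e \<cdot>\<^sub>v (s 0 \<cdot>\<^sub>v v)"
    using A ev by (simp add: mult_mat_vec[OF A] smult_smult_assoc mult.commute)
  then show thesis
    using that[of "W * mat_diag n s" e] s W col by (auto intro: mult_carrier_mat)
qed

definition spectral_mat :: "nat \<Rightarrow> complex mat \<Rightarrow> (nat \<Rightarrow> real) \<Rightarrow> complex mat" where
  "spectral_mat n U d = U * mat_diag n (\<lambda>i. complex_of_real (d i)) * mat_adjoint U"

lemma hermitian_mat_unitary_conj:
  assumes "A \<in> carrier_mat n n" "hermitian_mat A" "U \<in> carrier_mat n n"
  shows "hermitian_mat (mat_adjoint U * A * U)"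
  using assms
  by (auto simp: hermitian_mat_def mat_adjoint_mult[of _ n n _ n] assoc_mult_mat[of _ n n _ n _ n])

lemma unitary_conj_cancel:
  assumes U: "U \<in> carrier_mat n n" "unitary_mat U" and A: "A \<in> carrier_mat n n"
  shows "U * (mat_adjoint U * A * U) * mat_adjoint U = A"
proof -
  have "U * (mat_adjoint U * A * U) * mat_adjoint U = (U * mat_adjoint U) * A * (U * mat_adjoint U)"
    using U A by (simp add: assoc_mult_mat[of _ n n _ n _ n] mult_carrier_mat[of _ n n _ n])
  then show ?thesis using U A by (simp add: unitary_mat_mult_adjoint)
qed

lemma mult_block_diag:
  fixes A B A' B' :: "complex mat"
  assumes "A \<in> carrier_mat m m" "B \<in> carrier_mat n n" "A' \<in> carrier_mat m m" "B' \<in> carrier_mat n n"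
  shows "four_block_mat A (0\<^sub>m m n) (0\<^sub>m n m) B * four_block_mat A' (0\<^sub>m m n) (0\<^sub>m n m) B' =
         four_block_mat (A * A') (0\<^sub>m m n) (0\<^sub>m n m) (B * B')"
  using assms by (simp add: mult_four_block_mat[of _ m m _ n _ n _ _ m _ n])

text \<open>
  In a unitary basis whose first vector is an eigenvector, the first column of \<open>A\<close> is a multiple
  of the first unit vector; since the matrix stays Hermitian, so is the first row. The
  remaining block is Hermitian of size one less, and diagonalizing it by induction diagonalizes
  \<open>A\<close>.
\<close>
theorem hermitian_mat_spectral_decomposition:
  assumes "A \<in> carrier_mat n n" "hermitian_mat A"
  shows "\<exists>U d. U \<in> carrier_mat n n \<and> unitary_mat U \<and> A = spectral_mat n U d"
  using assms
proof (induction n arbitrary: A)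
  case 0
  then show ?case
    by (intro exI[of _ "1\<^sub>m 0"] exI[of _ "\<lambda>_. 0"])
       (auto simp: unitary_mat_def spectral_mat_def mat_diag_def intro!: eq_matI)
next
  case (Suc n)
  note A = Suc.prems(1)
  obtain U e where U: "U \<in> carrier_mat (Suc n) (Suc n)" "unitary_mat U"
    and ev: "A *\<^sub>v col U 0 = e \<cdot>\<^sub>v col U 0"
    using unitary_with_eigenvector_first[OF A] by blast
  define B where "B = mat_adjoint U * A * U"
  have B: "B \<in> carrier_mat (Suc n) (Suc n)" using U A by (auto simp: B_def)
  have hB: "hermitian_mat B"
    using hermitian_mat_unitary_conj[OF A Suc.prems(2) U(1)] by (simp add: B_def)
  have Bsym: "B $$ (i, j) = cnj (B $$ (j, i))" if "i < Suc n" "j < Suc n" for i j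
    using hB B that mat_adjoint_index[of i B j] by (auto simp: hermitian_mat_def)
  have "B $$ (i, 0) = (if i = 0 then e else 0)" if i: "i < Suc n" for i
  proof -
    have "col B 0 = mat_adjoint U *\<^sub>v (A *\<^sub>v col U 0)"
      unfolding B_def assoc_mult_mat[OF mat_adjoint_carrier[OF U(1)] A U(1)]
        col_mult2[OF mat_adjoint_carrier[OF U(1)] mult_carrier_mat[OF A U(1)] zero_less_Suc]
        col_mult2[OF A U(1) zero_less_Suc] ..
    also have "\<dots> = e \<cdot>\<^sub>v col (mat_adjoint U * U) 0"
      using U A ev by (auto simp: mult_mat_vec[of _ "Suc n" "Suc n"])
    also have "\<dots> = e \<cdot>\<^sub>v col (1\<^sub>m (Suc n)) 0"
      using U by (simp add: unitary_mat_mult_adjoint)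
    finally have "col B 0 $ i = (if i = 0 then e else 0)" using i by auto
    then show ?thesis using B i by auto
  qed
  note col0 = this
  have row0: "B $$ (0, i) = (if i = 0 then e else 0)" if "i < Suc n" for i
    using Bsym[of 0 i] Bsym[of 0 0] col0[of i] col0[of 0] that by auto
  have e: "e = complex_of_real (Re e)"
    using Bsym[of 0 0] col0[of 0] by (simp add: complex_eq_iff)
  define C where "C = mat n n (\<lambda>(i, j). B $$ (Suc i, Suc j))"
  have C: "C \<in> carrier_mat n n" by (simp add: C_def)
  have "hermitian_mat C"
    unfolding hermitian_mat_def using C by (auto intro!: eq_matI simp: C_def Bsym[symmetric])
  with Suc.IH[OF C] obtain V d where V: "V \<in> carrier_mat n n" "unitary_mat V"
    and Cd: "C = spectral_mat n V d" by blast
  define V' where "V' = four_block_mat (1\<^sub>m 1) (0\<^sub>m 1 n) (0\<^sub>m n 1) V"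
  have V': "V' \<in> carrier_mat (Suc n) (Suc n)"
    using V four_block_carrier_mat[of "1\<^sub>m 1" 1 1 V n n] by (simp add: V'_def)
  have adjV': "mat_adjoint V' = four_block_mat (1\<^sub>m 1) (0\<^sub>m 1 n) (0\<^sub>m n 1) (mat_adjoint V)"
    using V by (intro eq_matI) (auto simp: V'_def)
  define d' where "d' i = (case i of 0 \<Rightarrow> Re e | Suc j \<Rightarrow> d j)" for i
  (* e is real by hermiticity, so the real sequence d' loses nothing. *)
  have diag: "mat_diag (Suc n) (\<lambda>i. complex_of_real (d' i)) =
      four_block_mat (mat 1 1 (\<lambda>_. e)) (0\<^sub>m 1 n) (0\<^sub>m n 1) (mat_diag n (\<lambda>i. complex_of_real (d i)))"
    using e by (intro eq_matI) (auto simp: mat_diag_def d'_def split: nat.splits)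
  have uV': "unitary_mat V'"
  proof -
    have "mat_adjoint V' * V' = four_block_mat (1\<^sub>m 1) (0\<^sub>m 1 n) (0\<^sub>m n 1) (1\<^sub>m n)"
      unfolding adjV' unfolding V'_def using V
      by (simp add: mult_block_diag[of _ "Suc 0" _ n] unitary_mat_mult_adjoint)
    also have "\<dots> = 1\<^sub>m (Suc n)" by (intro eq_matI) auto
    finally show ?thesis using V' by (auto simp: unitary_mat_def)
  qed
  have "spectral_mat (Suc n) V' d' = four_block_mat (mat 1 1 (\<lambda>_. e)) (0\<^sub>m 1 n) (0\<^sub>m n 1) C"
    unfolding spectral_mat_def diag adjV' Cd unfolding V'_def using V
    by (simp add: mult_block_diag[of _ "Suc 0" _ n])
  also have "\<dots> = B"
    using B col0 row0 by (intro eq_matI) (auto simp: C_def)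
  finally have B_eq: "B = spectral_mat (Suc n) V' d'" ..
  have "A = U * B * mat_adjoint U"
    using unitary_conj_cancel[OF U A] by (simp add: B_def)
  also have "\<dots> = spectral_mat (Suc n) (U * V') d'"
    using U V' unfolding B_eq spectral_mat_def
    by (simp add: mat_adjoint_mult[of _ "Suc n" "Suc n" _ "Suc n"]
        assoc_mult_mat[of _ "Suc n" "Suc n" _ "Suc n" _ "Suc n"]
        mult_carrier_mat[of _ "Suc n" "Suc n" _ "Suc n"])
  finally have "A = spectral_mat (Suc n) (U * V') d'" .
  moreover have "U * V' \<in> carrier_mat (Suc n) (Suc n)"
    using U V' by (simp add: mult_carrier_mat[of _ "Suc n" "Suc n" _ "Suc n"])
  ultimately show ?case
    using unitary_mat_mult[OF U V' uV'] by blast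
qed


section \<open>Functions of a diagonalized matrix\<close>

lemma spectral_mat_carrier [simp, intro]:
  "U \<in> carrier_mat n n \<Longrightarrow> spectral_mat n U d \<in> carrier_mat n n"
  by (auto simp: spectral_mat_def mat_diag_def)

lemma spectral_mat_index:
  assumes "U \<in> carrier_mat n n" "i < n" "j < n"
  shows "spectral_mat n U d $$ (i, j) = (\<Sum>l<n. U $$ (i, l) * cnj (U $$ (j, l)) * complex_of_real (d l))"
  unfolding spectral_mat_def mat_diag_mult_right[OF assms(1)] using assms
  by (auto simp: scalar_prod_def lessThan_atLeast0 algebra_simps)

lemma unitary_mat_columns_orthonormal:
  assumes U: "U \<in> carrier_mat n n" "unitary_mat U" and "i < n" "j < n"
  shows "(\<Sum>k<n. cnj (U $$ (k, i)) * U $$ (k, j)) = (if i = j then 1 else 0)"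
proof -
  have "(mat_adjoint U * U) $$ (i, j) = (if i = j then 1 else 0)"
    using unitary_mat_mult_adjoint[OF U] assms by simp
  then show ?thesis using assms by (auto simp: scalar_prod_def lessThan_atLeast0)
qed

lemma mat_trace_spectral_mat:
  assumes U: "U \<in> carrier_mat n n" "unitary_mat U"
  shows "mat_trace (spectral_mat n U d) = complex_of_real (\<Sum>i<n. d i)"
proof -
  have "mat_trace (spectral_mat n U d) =
        (\<Sum>i<n. \<Sum>l<n. U $$ (i, l) * cnj (U $$ (i, l)) * complex_of_real (d l))"
    using U by (auto simp: mat_trace_def spectral_mat_index carrier_matD[OF spectral_mat_carrier])
  also have "\<dots> = (\<Sum>l<n. complex_of_real (d l) * (\<Sum>i<n. cnj (U $$ (i, l)) * U $$ (i, l)))"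
    by (subst sum.swap) (simp add: sum_distrib_left algebra_simps)
  also have "\<dots> = complex_of_real (\<Sum>i<n. d i)"
    using unitary_mat_columns_orthonormal[OF U] by simp
  finally show ?thesis .
qed

lemma spectral_mat_mult:
  assumes U: "U \<in> carrier_mat n n" "unitary_mat U"
  shows "spectral_mat n U d * spectral_mat n U e = spectral_mat n U (\<lambda>i. d i * e i)"
proof -
  let ?D = "mat_diag n (\<lambda>i. complex_of_real (d i))" and ?E = "mat_diag n (\<lambda>i. complex_of_real (e i))"
  have "spectral_mat n U d * spectral_mat n U e = U * (?D * ((mat_adjoint U * U) * (?E * mat_adjoint U)))"
    using U unfolding spectral_mat_def
    by (simp add: assoc_mult_mat[of _ n n _ n _ n] mult_carrier_mat[of _ n n _ n])
  also have "\<dots> = U * ((?D * ?E) * mat_adjoint U)"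
    unfolding unitary_mat_mult_adjoint[OF U] using U
    by (simp add: assoc_mult_mat[of _ n n _ n _ n] mult_carrier_mat[of _ n n _ n]
        left_mult_one_mat[of _ n n] del: mat_diag_diag)
  also have "\<dots> = spectral_mat n U (\<lambda>i. d i * e i)"
    using U unfolding spectral_mat_def by (simp add: assoc_mult_mat[of _ n n _ n _ n])
  finally show ?thesis .
qed

lemma spectral_mat_smult:
  assumes U: "U \<in> carrier_mat n n"
  shows "complex_of_real a \<cdot>\<^sub>m spectral_mat n U d = spectral_mat n U (\<lambda>i. a * d i)"
  using U carrier_matD[OF spectral_mat_carrier[OF U]]
  by (intro eq_matI) (auto simp: spectral_mat_index sum_distrib_left algebra_simps)

lemma spectral_mat_pow:
  assumes U: "U \<in> carrier_mat n n" "unitary_mat U"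
  shows "spectral_mat n U d ^\<^sub>m k = spectral_mat n U (\<lambda>i. d i ^ k)"
proof (induction k)
  case 0
  then show ?case
    using U carrier_matD[OF spectral_mat_carrier[OF U(1)]]
    by (simp add: spectral_mat_def unitary_mat_mult_adjoint)
next
  case (Suc k)
  then show ?case by (simp add: spectral_mat_mult[OF U] mult.commute)
qed

lemma mat_exp_spectral_mat:
  assumes U: "U \<in> carrier_mat n n" "unitary_mat U"
  shows "mat_exp (spectral_mat n U d) = spectral_mat n U (\<lambda>i. exp (d i))"
proof (rule eq_matI)
  note dims = carrier_matD[OF spectral_mat_carrier[OF U(1)]]
  fix i j assume "i < dim_row (spectral_mat n U (\<lambda>i. exp (d i)))"
    "j < dim_col (spectral_mat n U (\<lambda>i. exp (d i)))"
  then have ij: "i < n" "j < n" by (simp_all add: dims)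
  have "(\<lambda>k. complex_of_real (d l ^ k) / fact k) sums complex_of_real (exp (d l))" for l
    using sums_of_real[OF exp_converges[of "d l"], where 'a = complex]
    by (simp add: scaleR_conv_of_real divide_inverse mult.commute)
  then have "(\<lambda>k. \<Sum>l<n. U $$ (i, l) * cnj (U $$ (j, l)) * (complex_of_real (d l ^ k) / fact k)) sums
        (\<Sum>l<n. U $$ (i, l) * cnj (U $$ (j, l)) * complex_of_real (exp (d l)))"
    by (intro sums_sum sums_mult)
  then have "(\<lambda>k. (spectral_mat n U d ^\<^sub>m k) $$ (i, j) / fact k) sums
        (spectral_mat n U (\<lambda>i. exp (d i)) $$ (i, j))"
    by (simp add: spectral_mat_pow[OF U] spectral_mat_index[OF U(1) ij] sum_divide_distrib)
  then show "mat_exp (spectral_mat n U d) $$ (i, j) = spectral_mat n U (\<lambda>i. exp (d i)) $$ (i, j)"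
    using ij by (simp add: mat_exp_def dims sums_unique[symmetric])
qed (use carrier_matD[OF spectral_mat_carrier[OF U(1)]] in \<open>simp_all add: mat_exp_def\<close>)

text \<open>
  This ties the diagonal of any diagonalization to an invariant of the matrix. It identifies
  the ordered eigenvalues, and shows that two diagonalizations of one matrix agree up to the order
  of the diagonal.
\<close>
lemma proots_char_poly_spectral_mat:
  assumes U: "U \<in> carrier_mat n n" "unitary_mat U"
  shows "proots (char_poly (spectral_mat n U d)) = mset (map (\<lambda>i. complex_of_real (d i)) [0..<n])"
proof -
  let ?D = "mat_diag n (\<lambda>i. complex_of_real (d i))"
  have "similar_mat (spectral_mat n U d) ?D"
    by (rule similar_matI[where P = U and Q = "mat_adjoint U" and n = n])
       (use U in \<open>auto simp: unitary_mat_mult_adjoint spectral_mat_def mat_diag_def\<close>)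
  then have "char_poly (spectral_mat n U d) = char_poly ?D"
    by (rule char_poly_similar)
  also have "\<dots> = (\<Prod>a\<leftarrow>diag_mat ?D. [:- a, 1:])"
    by (rule char_poly_upper_triangular[of _ n]) (auto simp: mat_diag_def)
  also have "diag_mat ?D = map (\<lambda>i. complex_of_real (d i)) [0..<n]"
    by (auto simp: diag_mat_def mat_diag_def)
  finally have "char_poly (spectral_mat n U d) = (\<Prod>a\<leftarrow>map (\<lambda>i. complex_of_real (d i)) [0..<n]. [:- a, 1:])" .
  moreover have "proots (\<Prod>a\<leftarrow>xs. [:- a, 1:]) = mset xs" for xs :: "complex list"
  proof (induction xs)
    case (Cons x xs)
    have "(\<Prod>a\<leftarrow>xs. [:- a, 1:]) \<noteq> 0" by (auto simp: prod_list_zero_iff)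
    then show ?case using Cons by (simp add: proots_mult del: mult_pCons_left)
  qed simp
  ultimately show ?thesis by (simp only:)
qed

lemma sum_spectrum_unique:
  fixes g :: "real \<Rightarrow> real"
  assumes "U \<in> carrier_mat n n" "unitary_mat U" "V \<in> carrier_mat n n" "unitary_mat V"
    and "spectral_mat n U d = spectral_mat n V e"
  shows "(\<Sum>i<n. g (d i)) = (\<Sum>i<n. g (e i))"
proof -
  have *: "(\<Sum>i<n. g (f i)) = sum_mset (image_mset (g \<circ> Re) (mset (map (\<lambda>i. complex_of_real (f i)) [0..<n])))" for f
    by (simp add: sum_list_sum_nth atLeast0LessThan sum_mset_sum_list flip: mset_map)
  show ?thesis unfolding *
    using proots_char_poly_spectral_mat[OF assms(1,2)] proots_char_poly_spectral_mat[OF assms(3,4)] assms(5)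
    by metis
qed

lemma eigval_spectral_mat:
  assumes U: "U \<in> carrier_mat n n" "unitary_mat U"
  shows "eigval (spectral_mat n U d) (Suc i) = rev (sort (map d [0..<n])) ! i"
  unfolding eigval_def proots_char_poly_spectral_mat[OF U]
  by (simp add: o_def sorted_list_of_multiset_mset flip: mset_map)

lemma sum_eigval:
  fixes g :: "real \<Rightarrow> real"
  assumes U: "U \<in> carrier_mat n n" "unitary_mat U"
  shows "(\<Sum>i<n. g (d i)) = (\<Sum>i<n. g (eigval (spectral_mat n U d) (Suc i)))"
proof -
  define L where "L = rev (sort (map d [0..<n]))"
  have len: "length L = n" and L: "mset L = mset (map d [0..<n])" by (simp_all add: L_def)
  have "(\<Sum>i<n. g (L ! i)) = sum_mset (image_mset g (mset L))"
    using len by (simp add: sum_list_sum_nth atLeast0LessThan sum_mset_sum_list flip: mset_map)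
  also have "\<dots> = (\<Sum>i<n. g (d i))" unfolding L
    by (simp add: sum_list_sum_nth atLeast0LessThan sum_mset_sum_list flip: mset_map)
  finally show ?thesis by (simp add: eigval_spectral_mat[OF U] L_def)
qed

lemma eigval_antimono:
  assumes A: "A \<in> carrier_mat n n" "hermitian_mat A" and ij: "i \<le> j" "j < n"
  shows "eigval A (Suc j) \<le> eigval A (Suc i)"
proof -
  obtain U d where U: "U \<in> carrier_mat n n" "unitary_mat U" and Ad: "A = spectral_mat n U d"
    using hermitian_mat_spectral_decomposition[OF A] by blast
  show ?thesis
    unfolding Ad eigval_spectral_mat[OF U] using ij by (auto simp: rev_nth intro!: sorted_nth_mono)
qed

section \<open>Entropy of the Gibbs state\<close>

text \<open>
  The logarithm may be formed with a diagonalization \<open>(V, d)\<close> other than \<open>(U, p)\<close>. Writing the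
  state itself in terms of \<open>(V, d)\<close> gives a sum over \<open>d\<close>, which equals the sum over \<open>p\<close> by
  uniqueness of the spectrum.
\<close>
lemma vn_entropy_spectral_mat:
  assumes U: "U \<in> carrier_mat n n" "unitary_mat U"
  shows "vn_entropy (spectral_mat n U p) = - (\<Sum>i<n. p i * ln (p i))"
proof -
  let ?\<rho> = "spectral_mat n U p"
  have dim: "dim_row ?\<rho> = n" using carrier_matD[OF spectral_mat_carrier[OF U(1)]] by simp
  have "\<exists>V d. V \<in> carrier_mat n n \<and> unitary_mat V \<and> ?\<rho> = spectral_mat n V d \<and>
          mat_log ?\<rho> = spectral_mat n V (\<lambda>i. ln (d i))"
    unfolding mat_log_def herm_fun_def dim unfolding spectral_mat_def[symmetric]
    by (rule someI_ex) (use U in blast)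
  then obtain V d where V: "V \<in> carrier_mat n n" "unitary_mat V" and \<rho>: "?\<rho> = spectral_mat n V d"
    and log: "mat_log ?\<rho> = spectral_mat n V (\<lambda>i. ln (d i))" by blast
  have "vn_entropy ?\<rho> = - (\<Sum>i<n. d i * ln (d i))"
    unfolding vn_entropy_def log unfolding \<rho>
    by (simp add: spectral_mat_mult[OF V] mat_trace_spectral_mat[OF V])
  then show ?thesis
    using sum_spectrum_unique[OF U V \<rho>, of "\<lambda>x. x * ln x"] by simp
qed

lemma gibbs_state_spectral_mat:
  assumes U: "U \<in> carrier_mat n n" "unitary_mat U"
  shows "gibbs_state \<tau> (spectral_mat n U d) =
         spectral_mat n U (\<lambda>i. exp (- \<tau> * d i) / (\<Sum>j<n. exp (- \<tau> * d j)))"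
proof -
  let ?Z = "\<Sum>j<n. exp (- \<tau> * d j)"
  have exp: "mat_exp (complex_of_real (- \<tau>) \<cdot>\<^sub>m spectral_mat n U d) = spectral_mat n U (\<lambda>i. exp (- \<tau> * d i))"
    by (simp only: spectral_mat_smult[OF U(1)] mat_exp_spectral_mat[OF U])
  have "1 / complex_of_real ?Z = complex_of_real (1 / ?Z)" by (simp only: of_real_divide of_real_1)
  then show ?thesis
    unfolding gibbs_state_def Let_def exp mat_trace_spectral_mat[OF U]
    by (simp only: spectral_mat_smult[OF U(1)] times_divide_eq_left mult_1)
qed

text \<open>
  Insert \<open>ln (exp (-\<tau> d) / Z) = - \<tau> d - ln Z\<close> and use that the weights sum to one.
\<close>
lemma gibbs_entropy_formula:
  fixes d :: "nat \<Rightarrow> real" and \<tau> :: real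
  assumes "n > 0"
  defines "Z \<equiv> (\<Sum>j<n. exp (- \<tau> * d j))"
  shows "- (\<Sum>i<n. exp (- \<tau> * d i) / Z * ln (exp (- \<tau> * d i) / Z)) =
         ln Z + \<tau> * (\<Sum>i<n. d i * exp (- \<tau> * d i)) / Z"
proof -
  have Z: "Z > 0" unfolding Z_def using assms by (intro sum_pos) auto
  have "- (exp (- \<tau> * d i) / Z * ln (exp (- \<tau> * d i) / Z)) =
        exp (- \<tau> * d i) * (ln Z / Z) + \<tau> / Z * (d i * exp (- \<tau> * d i))" for i
    using Z by (simp add: ln_div field_simps)
  then have "- (\<Sum>i<n. exp (- \<tau> * d i) / Z * ln (exp (- \<tau> * d i) / Z)) =
        (\<Sum>i<n. exp (- \<tau> * d i) * (ln Z / Z)) + (\<Sum>i<n. \<tau> / Z * (d i * exp (- \<tau> * d i)))"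
    by (simp only: sum_negf[symmetric] sum.distrib)
  also have "(\<Sum>i<n. exp (- \<tau> * d i) * (ln Z / Z)) = Z * (ln Z / Z)"
    by (simp only: Z_def sum_distrib_right)
  also have "(\<Sum>i<n. \<tau> / Z * (d i * exp (- \<tau> * d i))) = \<tau> / Z * (\<Sum>i<n. d i * exp (- \<tau> * d i))"
    by (simp only: sum_distrib_left)
  finally show ?thesis using Z by simp
qed

lemma vn_entropy_gibbs_state:
  fixes \<tau> :: real
  assumes A: "A \<in> carrier_mat n n" "hermitian_mat A" and n: "n > 0"
  defines "ev \<equiv> \<lambda>i. eigval A (Suc i)"
  defines "Z \<equiv> (\<Sum>i<n. exp (- \<tau> * ev i))"
  shows "vn_entropy (gibbs_state \<tau> A) = ln Z + \<tau> * (\<Sum>i<n. ev i * exp (- \<tau> * ev i)) / Z"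
proof -
  obtain U d where U: "U \<in> carrier_mat n n" "unitary_mat U" and Ad: "A = spectral_mat n U d"
    using hermitian_mat_spectral_decomposition[OF A] by blast
  show ?thesis
    unfolding Z_def ev_def Ad gibbs_state_spectral_mat[OF U] vn_entropy_spectral_mat[OF U]
      gibbs_entropy_formula[OF n]
    unfolding sum_eigval[OF U, of "\<lambda>x. exp (- \<tau> * x)" d] sum_eigval[OF U, of "\<lambda>x. x * exp (- \<tau> * x)" d] ..
qed

section \<open>Averages over a clustering spectrum\<close>

text \<open>
  The first \<open>n - 1\<close> terms are uniformly close to \<open>g c\<close>, and the exceptional last term contributes
  only \<open>(g z - g c) / n\<close> to the deviation of the mean.
\<close>
lemma tendsto_average_of_clustering:
  fixes x :: "nat \<Rightarrow> nat \<Rightarrow> real" and g :: "real \<Rightarrow> real"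
  assumes g: "isCont g c" and lo: "lo \<longlonglongrightarrow> c" and hi: "hi \<longlonglongrightarrow> c"
    and bounds: "\<And>n i. n \<ge> 2 \<Longrightarrow> i < n - 1 \<Longrightarrow> lo n \<le> x n i \<and> x n i \<le> hi n"
    and last: "\<And>n. n \<ge> 2 \<Longrightarrow> x n (n - 1) = z"
  shows "(\<lambda>n. (\<Sum>i<n. g (x n i)) / real n) \<longlonglongrightarrow> g c"
proof (rule LIMSEQ_I)
  fix r :: real assume r: "r > 0"
  from g obtain s where s: "s > 0" "\<And>y. \<bar>y - c\<bar> < s \<Longrightarrow> \<bar>g y - g c\<bar> < r / 2"
    using r LIM_D[of g "g c" c "r / 2"] unfolding isCont_def
    by (metis abs_zero diff_self half_gt_zero real_norm_def)
  have "\<forall>\<^sub>F n in sequentially. c - s < lo n" "\<forall>\<^sub>F n in sequentially. hi n < c + s"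
    using s order_tendstoD(1)[OF lo, of "c - s"] order_tendstoD(2)[OF hi, of "c + s"] by auto
  moreover have "(\<lambda>n. \<bar>g z - g c\<bar> / real n) \<longlonglongrightarrow> 0"
    by (rule lim_const_over_n)
  then have "\<forall>\<^sub>F n in sequentially. \<bar>g z - g c\<bar> / real n < r / 2"
    using r by (intro order_tendstoD(2)) auto
  ultimately have "\<forall>\<^sub>F n in sequentially. norm ((\<Sum>i<n. g (x n i)) / real n - g c) < r"
    using eventually_ge_at_top[of 2]
  proof eventually_elim
    case (elim n)
    then obtain m where m: "n = Suc m" by (cases n) auto
    have close: "\<bar>g (x n i) - g c\<bar> \<le> r / 2" if "i < m" for i
    proof -
      have "lo n \<le> x n i" "x n i \<le> hi n" using bounds[of n i] that elim m by auto
      then have "\<bar>x n i - c\<bar> < s" using elim by linarith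
      then show ?thesis using s(2) less_imp_le by blast
    qed
    have "(\<Sum>i<n. g (x n i)) / real n - g c = (\<Sum>i<n. g (x n i) - g c) / real n"
      using elim by (simp add: sum_subtractf field_simps)
    also have "(\<Sum>i<n. g (x n i) - g c) = (\<Sum>i<m. g (x n i) - g c) + (g z - g c)"
      using last[of n] elim m by simp
    finally have "\<bar>(\<Sum>i<n. g (x n i)) / real n - g c\<bar> \<le> ((\<Sum>i<m. \<bar>g (x n i) - g c\<bar>) + \<bar>g z - g c\<bar>) / real n"
      by (simp add: divide_right_mono order_trans[OF abs_triangle_ineq] sum_abs add_mono)
    also have "\<dots> \<le> (real m * (r / 2) + \<bar>g z - g c\<bar>) / real n"
      using sum_bounded_above[of "{..<m}" "\<lambda>i. \<bar>g (x n i) - g c\<bar>" "r / 2"] close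
      by (intro divide_right_mono add_mono) auto
    also have "\<dots> \<le> r / 2 + \<bar>g z - g c\<bar> / real n"
      using r m by (simp add: field_simps)
    also have "\<dots> < r" using elim by linarith
    finally show ?case by simp
  qed
  then show "\<exists>no. \<forall>n\<ge>no. norm ((\<Sum>i<n. g (x n i)) / real n - g c) < r"
    by (simp add: eventually_sequentially)
qed

theorem theorem6:
  fixes \<tau> c :: real and H :: "nat \<Rightarrow> complex mat"
  assumes "\<tau> > 0"
    and dim: "\<And>n. n \<ge> 2 \<Longrightarrow> H n \<in> carrier_mat n n"
    and psd: "\<And>n. n \<ge> 2 \<Longrightarrow> psd_mat (H n)"
    and singular: "\<And>n. n \<ge> 2 \<Longrightarrow> det (H n) = 0"
    and simple_zero: "\<And>n. n \<ge> 2 \<Longrightarrow> order 0 (char_poly (H n)) = 1"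
    and eigval_last: "\<And>n. n \<ge> 2 \<Longrightarrow> eigval (H n) (n - 1) > eigval (H n) n \<and> eigval (H n) n = 0"
    and lim_max: "(\<lambda>n. eigval (H n) 1) \<longlonglongrightarrow> c"
    and lim_min: "(\<lambda>n. eigval (H n) (n - 1)) \<longlonglongrightarrow> c"
  shows "\<exists>\<epsilon> :: nat \<Rightarrow> real. \<epsilon> \<longlonglongrightarrow> 0 \<and>
           (\<forall>n\<ge>2. vn_entropy (gibbs_state \<tau> (H n)) = ln (real n) - \<epsilon> n)"
proof -
  have herm: "hermitian_mat (H n)" if "n \<ge> 2" for n
    using psd[OF that] by (simp add: psd_mat_def)
  define x where "x n i = eigval (H n) (Suc i)" for n i
  have bounds: "eigval (H n) (n - 1) \<le> x n i \<and> x n i \<le> eigval (H n) 1" if "n \<ge> 2" "i < n - 1" for n i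
    using eigval_antimono[OF dim[OF that(1)] herm[OF that(1)], of i "n - 2"]
      eigval_antimono[OF dim[OF that(1)] herm[OF that(1)], of 0 i] that
    by (auto simp: x_def Suc_diff_le numeral_2_eq_2 Suc_diff_Suc)
  have last: "x n (n - 1) = 0" if "n \<ge> 2" for n
    using eigval_last[OF that] that by (simp add: x_def)
  define z where "z n = (\<Sum>i<n. exp (- \<tau> * x n i)) / real n" for n
  define w where "w n = (\<Sum>i<n. x n i * exp (- \<tau> * x n i)) / real n" for n
  have z: "z \<longlonglongrightarrow> exp (- \<tau> * c)" unfolding z_def
    by (rule tendsto_average_of_clustering[where x = x and g = "\<lambda>y. exp (- \<tau> * y)", OF _ lim_min lim_max bounds last]) auto
  have w: "w \<longlonglongrightarrow> c * exp (- \<tau> * c)" unfolding w_def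
    by (rule tendsto_average_of_clustering[where x = x and g = "\<lambda>y. y * exp (- \<tau> * y)", OF _ lim_min lim_max bounds last]) auto
  have "(\<lambda>n. - (ln (z n) + \<tau> * w n / z n)) \<longlonglongrightarrow> - (ln (exp (- \<tau> * c)) + \<tau> * (c * exp (- \<tau> * c)) / exp (- \<tau> * c))"
    by (intro tendsto_intros z w) auto
  (* -\<tau> c from the logarithm cancels \<tau> c from the mean energy. *)
  then have "(\<lambda>n. - (ln (z n) + \<tau> * w n / z n)) \<longlonglongrightarrow> 0" by simp
  moreover have "vn_entropy (gibbs_state \<tau> (H n)) = ln (real n) - - (ln (z n) + \<tau> * w n / z n)" if n: "n \<ge> 2" for n
  proof -
    define Z where "Z = (\<Sum>i<n. exp (- \<tau> * x n i))"
    have Z: "Z > 0" unfolding Z_def using n by (intro sum_pos) (auto simp: lessThan_empty_iff)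
    have z_eq: "z n = Z / real n" by (simp add: z_def Z_def)
    have "vn_entropy (gibbs_state \<tau> (H n)) = ln Z + \<tau> * (\<Sum>i<n. x n i * exp (- \<tau> * x n i)) / Z"
      using vn_entropy_gibbs_state[OF dim[OF n] herm[OF n], of \<tau>] n by (simp add: Z_def x_def)
    also have "ln Z = ln (real n) + ln (z n)"
      using Z n by (simp add: z_eq ln_div)
    also have "\<tau> * (\<Sum>i<n. x n i * exp (- \<tau> * x n i)) / Z = \<tau> * w n / z n"
      using n by (simp add: w_def z_eq)
    finally show ?thesis by simp
  qed
  ultimately show ?thesis by blast
qed

end
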